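(* Let $S$ be a numerical semigroup minimally generated by $\{n_1,\ldots,n_p\}$ ($p$ distinct elements), $p\ge 2$. For each $i\in\{1,\ldots,p\}$ set $$c_i=\min\{k\in\mathbb{N}\setminus\{0\}\mid k n_i\in\langle n_1,\ldots,n_{i-1},n_{i+1},\ldots,n_p\rangle\}.$$ The following conditions are equivalent: 1. The set $\mathrm{Betti}(S)$ is a singleton. 2. There exist pairwise relatively prime integers $k_1,\ldots,k_p$ greater than one such that $n_i=\prod_{j\neq i}k_j$ for all $i\in\{1,\ldots,p\}$. Furthermore, if this is the case, then $k_i=c_i$ for $i=1,\ldots,p$ and $\mathrm{Betti}(S)=\{c_1n_1\}=\{c_in_i\mid i\in\{1,\ldots,p\}\}$.
   Context: $\mathbb{N}$ denotes the nonnegative integers. A numerical semigroup is a submonoid of $\mathbb{N}$ with finite complement in $\mathbb{N}$. $\langle m_1,\ldots,m_t\rangle$ denotes the submonoid of $\mathbb{N}$ generated by $m_1,\ldots,m_t$; $S$ is minimally generated by $\{n_1,\ldots,n_p\}$ if this set generates $S$ and no proper subset of it does. Let $\pi:\mathbb{N}^p\to S$, $(u_1,\ldots,u_p)\mapsto\sum_{i=1}^p u_in_i$, and let $\equiv$ be its kernel congruence, i.e. the set of pairs $(\mathbf{u},\mathbf{v})\in\mathbb{N}^p\times\mathbb{N}^p$ with $\pi(\mathbf{u})=\pi(\mathbf{v})$. A presentation of $S$ is a set $\sigma\subseteq\mathbb{N}^p\times\mathbb{N}^p$ such that $\equiv$ is the least congruence on $\mathbb{N}^p$ containing $\sigma$;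 it is minimal if no proper subset of it generates $\equiv$ as a congruence. $\mathrm{Betti}(S)=\{\pi(\mathbf{u})\mid(\mathbf{u},\mathbf{v})\in\sigma\}$ for a minimal presentation $\sigma$ of $S$; this set is known not to depend on the choice of $\sigma$. *)

theory Defs
  imports Complex_Main
begin

definition submonoid :: "nat set \<Rightarrow> bool" where
  "submonoid M \<longleftrightarrow> 0 \<in> M \<and> (\<forall>x\<in>M. \<forall>y\<in>M. x + y \<in> M)"

definition numerical_semigroup :: "nat set \<Rightarrow> bool" where
  "numerical_semigroup S \<longleftrightarrow> submonoid S \<and> finite (UNIV - S)"

definition generated :: "nat set \<Rightarrow> nat set" where
  "generated A = submonoid hull A"

definition minimally_generates :: "nat set \<Rightarrow> nat set \<Rightarrow> bool" where
  "minimally_generates A S \<longleftrightarrow> generated A = S \<and> (\<forall>B. B \<subset> A \<longrightarrow> generated B \<noteq> S)"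

text \<open>The monoid of p-tuples of natural numbers: functions supported on the index set
  \<open>{1..p}\<close>, so that each tuple has exactly one representation.\<close>

definition tuples :: "nat \<Rightarrow> (nat \<Rightarrow> nat) set" where
  "tuples p = {u. \<forall>i. i \<notin> {1..p} \<longrightarrow> u i = 0}"

definition factor_hom :: "nat \<Rightarrow> (nat \<Rightarrow> nat) \<Rightarrow> (nat \<Rightarrow> nat) \<Rightarrow> nat" where
  "factor_hom p n u = (\<Sum>i=1..p. u i * n i)"

definition kernel_congruence ::
  "nat \<Rightarrow> (nat \<Rightarrow> nat) \<Rightarrow> ((nat \<Rightarrow> nat) \<times> (nat \<Rightarrow> nat)) set" where
  "kernel_congruence p n =
     {(u, v). u \<in> tuples p \<and> v \<in> tuples p \<and> factor_hom p n u = factor_hom p n v}"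

definition tuple_congruence ::
  "nat \<Rightarrow> ((nat \<Rightarrow> nat) \<times> (nat \<Rightarrow> nat)) set \<Rightarrow> bool" where
  "tuple_congruence p r \<longleftrightarrow> equiv (tuples p) r \<and>
     (\<forall>(u, v)\<in>r. \<forall>w\<in>tuples p. (\<lambda>i. u i + w i, \<lambda>i. v i + w i) \<in> r)"

definition presentation ::
  "nat \<Rightarrow> (nat \<Rightarrow> nat) \<Rightarrow> ((nat \<Rightarrow> nat) \<times> (nat \<Rightarrow> nat)) set \<Rightarrow> bool" where
  "presentation p n \<sigma> \<longleftrightarrow>
     \<sigma> \<subseteq> tuples p \<times> tuples p \<and> tuple_congruence p hull \<sigma> = kernel_congruence p n"

definition minimal_presentation ::
  "nat \<Rightarrow> (nat \<Rightarrow> nat) \<Rightarrow> ((nat \<Rightarrow> nat) \<times> (nat \<Rightarrow> nat)) set \<Rightarrow> bool" where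
  "minimal_presentation p n \<sigma> \<longleftrightarrow>
     presentation p n \<sigma> \<and> (\<forall>\<tau>. \<tau> \<subset> \<sigma> \<longrightarrow> \<not> presentation p n \<tau>)"

text \<open>The Betti elements of the semigroup minimally generated by \<open>n 1, \<dots>, n p\<close>. Minimal
  presentations exist for every numerical semigroup, and the set does not depend on the one
  that is chosen.\<close>

definition Betti :: "nat \<Rightarrow> (nat \<Rightarrow> nat) \<Rightarrow> nat set" where
  "Betti p n =
     (let \<sigma> = (SOME \<sigma>. minimal_presentation p n \<sigma>) in {factor_hom p n u | u v. (u, v) \<in> \<sigma>})"

definition least_mult :: "nat \<Rightarrow> (nat \<Rightarrow> nat) \<Rightarrow> nat \<Rightarrow> nat" where
  "least_mult p n i = (LEAST k. k \<noteq> 0 \<and> k * n i \<in> generated (n ` ({1..p} - {i})))"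

definition coprime_product_form :: "nat \<Rightarrow> (nat \<Rightarrow> nat) \<Rightarrow> (nat \<Rightarrow> nat) \<Rightarrow> bool" where
  "coprime_product_form p n k \<longleftrightarrow>
     (\<forall>i\<in>{1..p}. k i > 1) \<and>
     pairwise (\<lambda>i j. coprime (k i) (k j)) {1..p} \<and>
     (\<forall>i\<in>{1..p}. n i = (\<Prod>j\<in>{1..p} - {i}. k j))"

end

theory Submission
  imports Defs "HOL-Number_Theory.Cong"
begin

text \<open>Call two tuples in the same fibre of \<open>\<pi>\<close> linked if their supports meet. Linked tuples
  share a unit vector whose removal leads to a smaller degree, so by induction on the degree a
  set of pairs presents the semigroup iff, together with the links, it connects every fibre.
  Hence the Betti elements are the degrees whose fibre is disconnected under linking.

  The tuple \<open>c_i e_i\<close> is isolated in its fibre, so every \<open>c_i n_i\<close> is a Betti element. If there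
  is only one, its fibre is \<open>{c_1 e_1, \<dots>, c_p e_p}\<close>, and so congruent tuples agree
  modulo \<open>c_i\<close> in the \<open>i\<close>-th entry. Applied to pairs of multiples of unit vectors this yields
  \<open>c_i dvd n_j\<close> and the coprimality of \<open>c_i\<close> and \<open>c_j\<close>; the remaining common factor of all
  \<open>n_i\<close> is one because the complement of the semigroup is finite. Conversely, if
  \<open>n_i\<close> is the product of the other \<open>k_j\<close>, reduction modulo \<open>k_i\<close> gives the same
  entrywise congruences, and trading \<open>k_i e_i\<close> for \<open>k_j e_j\<close> connects every fibre except that of
  the product of all \<open>k_j\<close>.\<close>

section \<open>Tuples, the factorization map and congruences\<close>

lemma kernel_congruence_iff:
  "(u, v) \<in> kernel_congruence p n \<longleftrightarrow>
    u \<in> tuples p \<and> v \<in> tuples p \<and> factor_hom p n u = factor_hom p n v"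
  by (simp add: kernel_congruence_def)

lemma factor_hom_add:
  "factor_hom p n (\<lambda>i. u i + w i) = factor_hom p n u + factor_hom p n w"
  by (simp add: factor_hom_def algebra_simps sum.distrib)

lemma factor_hom_single:
  assumes "i \<in> {1..p}"
  shows "factor_hom p n (\<lambda>j. if j = i then m else 0) = m * n i"
proof -
  have "factor_hom p n (\<lambda>j. if j = i then m else 0) = (\<Sum>j=1..p. if j = i then m * n i else 0)"
    unfolding factor_hom_def by (rule sum.cong) auto
  then show ?thesis using assms by simp
qed

lemma single_in_tuples: "i \<in> {1..p} \<Longrightarrow> (\<lambda>j. if j = i then m else 0) \<in> tuples p"
  by (auto simp: tuples_def)

lemma tuples_add: "u \<in> tuples p \<Longrightarrow> w \<in> tuples p \<Longrightarrow> (\<lambda>i. u i + w i) \<in> tuples p"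
  by (auto simp: tuples_def)

lemma tuples_support: "u \<in> tuples p \<Longrightarrow> u i > 0 \<Longrightarrow> i \<in> {1..p}"
  by (auto simp: tuples_def)

lemma tuples_split:
  fixes u :: "nat \<Rightarrow> nat"
  assumes "u \<in> tuples p" "i \<in> {1..p}" "m \<le> u i"
  obtains w where "w \<in> tuples p" "u = (\<lambda>j. w j + (if j = i then m else 0))"
    "factor_hom p n u = factor_hom p n w + m * n i"
proof
  let ?w = "u(i := u i - m)"
  show "?w \<in> tuples p" using assms by (auto simp: tuples_def)
  show u: "u = (\<lambda>j. ?w j + (if j = i then m else 0))" using assms by auto
  show "factor_hom p n u = factor_hom p n ?w + m * n i"
    by (subst u, subst factor_hom_add, subst factor_hom_single) (use assms in auto)
qed

lemma kernel_tuple_congruence: "tuple_congruence p (kernel_congruence p n)"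
  unfolding tuple_congruence_def
  by (auto intro!: equivI refl_onI symI transI tuples_add
      simp: kernel_congruence_def factor_hom_add)

lemma tuple_congruence_add:
  assumes "tuple_congruence p r" "(u, v) \<in> r" "w \<in> tuples p"
  shows "(\<lambda>i. u i + w i, \<lambda>i. v i + w i) \<in> r"
  using assms by (auto simp: tuple_congruence_def)

text \<open>The hull is an intersection over a nonempty family because the full relation is a
  congruence; \<open>hull_in\<close> does not apply, as the empty intersection is not a congruence.\<close>

lemma hull_tuple_congruence:
  assumes "\<sigma> \<subseteq> tuples p \<times> tuples p"
  shows "tuple_congruence p (tuple_congruence p hull \<sigma>)"
proof -
  let ?F = "{r. tuple_congruence p r \<and> \<sigma> \<subseteq> r}"
  have full: "tuples p \<times> tuples p \<in> ?F"
    using assms by (auto simp: tuple_congruence_def tuples_add intro!: equivI refl_onI symI transI)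
  have *: "equiv (tuples p) r"
    "\<And>u v w. (u, v) \<in> r \<Longrightarrow> w \<in> tuples p \<Longrightarrow> (\<lambda>i. u i + w i, \<lambda>i. v i + w i) \<in> r"
    if "r \<in> ?F" for r
    using that by (auto simp: tuple_congruence_def)
  have "equiv (tuples p) (\<Inter>?F)"
  proof (rule equivI)
    show "\<Inter>?F \<subseteq> tuples p \<times> tuples p" using full by blast
    show "refl_on (tuples p) (\<Inter>?F)"
      using *(1) by (fastforce intro!: refl_onI simp: equiv_def refl_on_def)
    show "sym (\<Inter>?F)"
      using *(1) unfolding equiv_def sym_def by blast
    show "trans (\<Inter>?F)"
      using *(1) unfolding equiv_def trans_def by blast
  qed
  moreover have "\<forall>(u, v)\<in>\<Inter>?F. \<forall>w\<in>tuples p. (\<lambda>i. u i + w i, \<lambda>i. v i + w i) \<in> \<Inter>?F"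
    using *(2) by blast
  ultimately show ?thesis unfolding hull_def tuple_congruence_def by blast
qed


section \<open>Betti elements and connectedness of fibres\<close>

text \<open>Adjacency in the graph of factorizations, where an edge means a nonzero dot product; its
  components inside a fibre are the R-classes. The zero tuple is not linked to itself, so for it
  reflexivity comes only from the closure.\<close>

definition linked :: "nat \<Rightarrow> (nat \<Rightarrow> nat) \<Rightarrow> ((nat \<Rightarrow> nat) \<times> (nat \<Rightarrow> nat)) set" where
  "linked p n = {(u, v) \<in> kernel_congruence p n. \<exists>i. u i > 0 \<and> v i > 0}"

definition disconnected_degrees :: "nat \<Rightarrow> (nat \<Rightarrow> nat) \<Rightarrow> nat set" where
  "disconnected_degrees p n =
     {factor_hom p n u | u v. (u, v) \<in> kernel_congruence p n \<and> (u, v) \<notin> (linked p n)\<^sup>*}"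

lemma linkedI: "(u, v) \<in> kernel_congruence p n \<Longrightarrow> u i > 0 \<Longrightarrow> v i > 0 \<Longrightarrow> (u, v) \<in> linked p n"
  by (auto simp: linked_def)

lemma linked_kernel: "linked p n \<subseteq> kernel_congruence p n"
  by (auto simp: linked_def)

lemma sym_kernel: "sym (kernel_congruence p n)"
  by (auto simp: sym_def kernel_congruence_def)

lemma sym_linked: "sym (linked p n)"
  by (auto simp: sym_def linked_def kernel_congruence_def)

lemma sym_linked_rtrancl: "(u, v) \<in> (linked p n)\<^sup>* \<Longrightarrow> (v, u) \<in> (linked p n)\<^sup>*"
  using sym_linked sym_rtrancl symE by metis

lemma rtrancl_kernel:
  assumes "(u, v) \<in> r\<^sup>*" "r \<subseteq> kernel_congruence p n" "u \<in> tuples p"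
  shows "(u, v) \<in> kernel_congruence p n"
  using assms by (induction rule: rtrancl_induct) (auto simp: kernel_congruence_def)

lemma factor_hom_rtrancl_linked:
  assumes "(u, v) \<in> (linked p n)\<^sup>*"
  shows "factor_hom p n u = factor_hom p n v"
  using assms by (induction rule: rtrancl_induct) (auto simp: linked_def kernel_congruence_def)

lemma linked_add:
  assumes "(u, v) \<in> kernel_congruence p n" "w \<in> tuples p" "w i > 0"
  shows "(\<lambda>i. u i + w i, \<lambda>i. v i + w i) \<in> linked p n"
  using assms by (auto simp: linked_def kernel_congruence_iff tuples_add factor_hom_add)

text \<open>Trades generation of a congruence for connectivity of a graph on each fibre. Closure
  under translation is absorbed by \<open>linked\<close>: adding a nonzero tuple to both sides of a
  kernel pair makes their supports meet. Conversely, positivity of the generators lets a linked pair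
  be reduced to a pair of smaller degree.\<close>

lemma presentation_iff_connects:
  assumes pos: "\<forall>i\<in>{1..p}. n i > 0"
  shows "presentation p n \<sigma> \<longleftrightarrow>
    \<sigma> \<subseteq> kernel_congruence p n \<and> kernel_congruence p n \<subseteq> (\<sigma> \<union> \<sigma>\<inverse> \<union> linked p n)\<^sup>*"
    (is "?P \<longleftrightarrow> \<sigma> \<subseteq> ?K \<and> ?K \<subseteq> ?R\<^sup>*")
proof (intro iffI conjI)
  assume P: ?P
  then have hull: "tuple_congruence p hull \<sigma> = ?K" and "\<sigma> \<subseteq> tuples p \<times> tuples p"
    by (auto simp: presentation_def)
  show sub: "\<sigma> \<subseteq> ?K" using hull hull_subset by metis
  have "sym ?R" using sym_linked by (auto simp: sym_def)
  then have symR: "sym (?R\<^sup>*)" by (rule sym_rtrancl)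
  \<comment> \<open>The reflexive closure also relates functions that are not tuples, hence the
    intersection with the kernel.\<close>
  have "tuple_congruence p (?K \<inter> ?R\<^sup>*)"
    unfolding tuple_congruence_def
  proof (intro conjI equivI)
    show "?K \<inter> ?R\<^sup>* \<subseteq> tuples p \<times> tuples p" by (auto simp: kernel_congruence_def)
    show "refl_on (tuples p) (?K \<inter> ?R\<^sup>*)" by (auto intro!: refl_onI simp: kernel_congruence_def)
    show "sym (?K \<inter> ?R\<^sup>*)" using symR sym_kernel by (rule sym_Int[rotated])
    show "trans (?K \<inter> ?R\<^sup>*)"
      by (rule trans_Int) (auto simp: trans_def kernel_congruence_def)
    show "\<forall>(u, v)\<in>?K \<inter> ?R\<^sup>*. \<forall>w\<in>tuples p. (\<lambda>i. u i + w i, \<lambda>i. v i + w i) \<in> ?K \<inter> ?R\<^sup>*"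
    proof clarify
      fix u v w assume uv: "(u, v) \<in> ?K" "(u, v) \<in> ?R\<^sup>*" and w: "w \<in> tuples p"
      show "(\<lambda>i. u i + w i, \<lambda>i. v i + w i) \<in> ?K \<inter> ?R\<^sup>*"
      proof (cases "\<exists>i. w i > 0")
        case True
        then show ?thesis using linked_add[OF uv(1) w] linked_kernel by blast
      next
        case False
        then show ?thesis using uv by simp
      qed
    qed
  qed
  moreover have "\<sigma> \<subseteq> ?K \<inter> ?R\<^sup>*" using sub by blast
  ultimately show "?K \<subseteq> ?R\<^sup>*" using hull hull_minimal by blast
next
  assume *: "\<sigma> \<subseteq> ?K \<and> ?K \<subseteq> ?R\<^sup>*"
  then have sub: "\<sigma> \<subseteq> tuples p \<times> tuples p" by (auto simp: kernel_congruence_def)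
  define T where "T = tuple_congruence p hull \<sigma>"
  have cong: "tuple_congruence p T" unfolding T_def by (rule hull_tuple_congruence[OF sub])
  have "\<sigma> \<subseteq> T" unfolding T_def by (rule hull_subset)
  have TK: "T \<subseteq> ?K" unfolding T_def using * kernel_tuple_congruence by (simp add: hull_minimal)
  have T: "refl_on (tuples p) T" "sym T" "trans T"
    using cong by (auto simp: tuple_congruence_def equiv_def)
  \<comment> \<open>Strong induction on the degree \<open>s\<close>, with an inner induction along a
    path. A path step in \<open>\<sigma>\<close> or its converse is immediate; a link is cancelled
    by a shared unit vector, which lowers the degree by \<open>n i\<close>, and is restored by
    translation.\<close>
  have "(u, v) \<in> ?K \<Longrightarrow> factor_hom p n u = s \<Longrightarrow> (u, v) \<in> T" for u v s
  proof (induction s arbitrary: u v rule: less_induct)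
    case (less s)
    then have u: "u \<in> tuples p" by (simp add: kernel_congruence_iff)
    have "(u, v) \<in> ?R\<^sup>*" using * less.prems by blast
    then show ?case
    proof (induction rule: rtrancl_induct)
      case base
      show ?case using T(1) u by (simp add: refl_on_def)
    next
      case (step y z)
      have "(y, z) \<in> T" if L: "(y, z) \<in> linked p n"
      proof -
        obtain i where yi: "y i > 0" and zi: "z i > 0" using L by (auto simp: linked_def)
        have yz: "y \<in> tuples p" "z \<in> tuples p" "factor_hom p n y = factor_hom p n z"
          using L by (auto simp: linked_def kernel_congruence_iff)
        \<comment> \<open>The part of the path already traversed lies in \<open>T\<close>, hence in
          the kernel, so \<open>y\<close> is still in the fibre of \<open>s\<close>.\<close>
        have ys: "factor_hom p n y = s"
          using step.IH TK less.prems by (auto simp: kernel_congruence_iff)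
        have i: "i \<in> {1..p}" using tuples_support yz yi by blast
        let ?e = "\<lambda>j. if j = i then 1 else 0 :: nat"
        have "1 \<le> y i" "1 \<le> z i" using yi zi by auto
        obtain y' where y': "y' \<in> tuples p" "y = (\<lambda>j. y' j + ?e j)"
          "factor_hom p n y = factor_hom p n y' + 1 * n i"
          using tuples_split[OF yz(1) i \<open>1 \<le> y i\<close>] by blast
        obtain z' where z': "z' \<in> tuples p" "z = (\<lambda>j. z' j + ?e j)"
          "factor_hom p n z = factor_hom p n z' + 1 * n i"
          using tuples_split[OF yz(2) i \<open>1 \<le> z i\<close>] by blast
        have "(y', z') \<in> ?K" using y' z' yz by (simp add: kernel_congruence_iff)
        moreover have "factor_hom p n y' < s" using y'(3) ys pos i by simp
        ultimately have "(y', z') \<in> T" using less.IH by blast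
        then show ?thesis
          unfolding y'(2) z'(2) using single_in_tuples[OF i] by (rule tuple_congruence_add[OF cong])
      qed
      then have "(y, z) \<in> T" using step.hyps \<open>\<sigma> \<subseteq> T\<close> T(2) by (auto simp: sym_def)
      then show ?case using step.IH T(3) by (blast intro: transD)
    qed
  qed
  then show ?P using TK sub unfolding presentation_def T_def[symmetric] by auto
qed

text \<open>A star in each fibre, joining a base point to one representative of every other
  \<open>linked\<close>-component, is a minimal presentation.\<close>

lemma minimal_presentation_exists:
  assumes pos: "\<forall>i\<in>{1..p}. n i > 0"
  shows "\<exists>\<sigma>. minimal_presentation p n \<sigma>"
proof -
  let ?L = "(linked p n)\<^sup>*" and ?K = "kernel_congruence p n" and ?\<pi> = "factor_hom p n"
  define rep where "rep u = (SOME v. (u, v) \<in> ?L)" for u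
  define base where "base s = (SOME u. u \<in> tuples p \<and> ?\<pi> u = s)" for s
  define \<sigma> where "\<sigma> = {(base (?\<pi> u), rep u) | u. u \<in> tuples p \<and> (base (?\<pi> u), u) \<notin> ?L}"
  have rep: "(u, rep u) \<in> ?L" for u
    unfolding rep_def by (rule someI[of _ u]) simp
  \<comment> \<open>Linked tuples reach the same tuples, so the choice operator is applied to one
    and the same predicate.\<close>
  have rep_eq: "rep u = rep v" if "(u, v) \<in> ?L" for u v
  proof -
    have "(u, w) \<in> ?L \<longleftrightarrow> (v, w) \<in> ?L" for w
      using that sym_linked_rtrancl[OF that] by (blast intro: rtrancl_trans)
    then show ?thesis unfolding rep_def by simp
  qed
  have base: "base (?\<pi> u) \<in> tuples p \<and> ?\<pi> (base (?\<pi> u)) = ?\<pi> u" if "u \<in> tuples p" for u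
    unfolding base_def by (rule someI[of _ u]) (use that in simp)
  have sub: "\<sigma> \<subseteq> ?K"
  proof
    fix x assume "x \<in> \<sigma>"
    then obtain u where u: "u \<in> tuples p" and x: "x = (base (?\<pi> u), rep u)"
      by (auto simp: \<sigma>_def)
    show "x \<in> ?K"
      using base[OF u] rtrancl_kernel[OF rep[of u] linked_kernel u]
      unfolding x kernel_congruence_iff by simp
  qed
  have to_base: "(base (?\<pi> u), u) \<in> (\<sigma> \<union> \<sigma>\<inverse> \<union> linked p n)\<^sup>*" (is "_ \<in> ?R\<^sup>*")
    if "u \<in> tuples p" for u
  proof (cases "(base (?\<pi> u), u) \<in> ?L")
    case True
    then show ?thesis using rtrancl_mono[of "linked p n" ?R] by blast
  next
    case False
    then have "(base (?\<pi> u), rep u) \<in> ?R" using that by (auto simp: \<sigma>_def)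
    moreover have "(rep u, u) \<in> ?R\<^sup>*"
      using sym_linked_rtrancl[OF rep] rtrancl_mono[of "linked p n" ?R] by blast
    ultimately show ?thesis by (rule converse_rtrancl_into_rtrancl)
  qed
  have "sym (?R\<^sup>*)" using sym_linked by (intro sym_rtrancl) (auto simp: sym_def)
  then have "?K \<subseteq> ?R\<^sup>*"
    using to_base by (auto simp: kernel_congruence_iff) (metis rtrancl_trans symE)
  then have pres: "presentation p n \<sigma>"
    using sub by (simp add: presentation_iff_connects[OF pos])
  have "\<not> presentation p n \<tau>" if \<tau>: "\<tau> \<subset> \<sigma>" for \<tau>
  proof
    assume "presentation p n \<tau>"
    then have conn: "?K \<subseteq> (\<tau> \<union> \<tau>\<inverse> \<union> linked p n)\<^sup>*"
      using presentation_iff_connects[OF pos] by blast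
    obtain u where u: "u \<in> tuples p" "(base (?\<pi> u), u) \<notin> ?L" "(base (?\<pi> u), rep u) \<notin> \<tau>"
      using \<tau> by (auto simp: \<sigma>_def)
    \<comment> \<open>In \<open>\<sigma>\<close> the only edge touching the component of
      \<open>u\<close> joins the base point to \<open>rep u\<close>, and \<open>\<tau>\<close> lacks
      it. So no edge of \<open>\<tau>\<close> touches this component, and a path from
      \<open>u\<close> to the base point would consist of links alone.\<close>
    have no_edge: "(u, x) \<notin> ?L \<and> (u, y) \<notin> ?L" if xy: "(x, y) \<in> \<tau>" for x y
    proof -
      obtain w where w: "w \<in> tuples p" "x = base (?\<pi> w)" "y = rep w"
        using xy \<tau> by (auto simp: \<sigma>_def)
      have deg: "?\<pi> w = ?\<pi> u" if "(u, x) \<in> ?L \<or> (u, y) \<in> ?L"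
        using that factor_hom_rtrancl_linked[OF rep[of w]] base[OF w(1)] w
        by (metis factor_hom_rtrancl_linked)
      have "(u, x) \<notin> ?L" using deg u(2) sym_linked_rtrancl w(2) by metis
      moreover have "(u, y) \<notin> ?L"
      proof
        assume y: "(u, y) \<in> ?L"
        then have "(u, w) \<in> ?L" using sym_linked_rtrancl[OF rep[of w]] w(3) rtrancl_trans by metis
        then have "rep u = rep w" by (rule rep_eq)
        then show False using deg y u(3) w xy by metis
      qed
      ultimately show ?thesis by blast
    qed
    have "(u, base (?\<pi> u)) \<in> (\<tau> \<union> \<tau>\<inverse> \<union> linked p n)\<^sup>*"
      using conn u(1) base[OF u(1)] by (auto simp: kernel_congruence_iff)
    then have "(u, base (?\<pi> u)) \<in> ?L"
    proof (induction rule: rtrancl_induct)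
      case (step y z)
      then show ?case using no_edge by (auto intro: rtrancl_into_rtrancl)
    qed simp
    then show False using u(2) sym_linked_rtrancl by blast
  qed
  then show ?thesis using pres unfolding minimal_presentation_def by blast
qed

text \<open>A pair inside one component is redundant, while a disconnected fibre can only be joined
  by a pair of its own degree. The right-hand side does not mention \<open>\<sigma>\<close>, so the
  choice made in \<open>Betti\<close> does not matter.\<close>

lemma minimal_presentation_degrees:
  assumes pos: "\<forall>i\<in>{1..p}. n i > 0"
    and min: "minimal_presentation p n \<sigma>"
  shows "{factor_hom p n u | u v. (u, v) \<in> \<sigma>} = disconnected_degrees p n"
proof (intro subset_antisym subsetI)
  let ?L = "linked p n" and ?K = "kernel_congruence p n"
  have sub: "\<sigma> \<subseteq> ?K" and conn: "?K \<subseteq> (\<sigma> \<union> \<sigma>\<inverse> \<union> ?L)\<^sup>*"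
    using min presentation_iff_connects[OF pos] by (auto simp: minimal_presentation_def)
  {
    fix s assume "s \<in> {factor_hom p n u | u v. (u, v) \<in> \<sigma>}"
    then obtain u v where uv: "(u, v) \<in> \<sigma>" "s = factor_hom p n u" by blast
    have "(u, v) \<notin> ?L\<^sup>*"
    proof
      assume L: "(u, v) \<in> ?L\<^sup>*"
      let ?\<tau> = "\<sigma> - {(u, v)}"
      let ?R = "?\<tau> \<union> ?\<tau>\<inverse> \<union> ?L"
      have "?L\<^sup>* \<subseteq> ?R\<^sup>*" by (rule rtrancl_mono) blast
      then have "(u, v) \<in> ?R\<^sup>*" "(v, u) \<in> ?R\<^sup>*" using L sym_linked_rtrancl by blast+
      \<comment> \<open>The removed pair is replaced, in both directions, by a path of
        links.\<close>
      then have "\<sigma> \<union> \<sigma>\<inverse> \<union> ?L \<subseteq> ?R\<^sup>*" by auto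
      then have "(\<sigma> \<union> \<sigma>\<inverse> \<union> ?L)\<^sup>* \<subseteq> ?R\<^sup>*" by (rule rtrancl_subset_rtrancl)
      then have "presentation p n ?\<tau>"
        using sub conn presentation_iff_connects[OF pos, where \<sigma> = ?\<tau>] by blast
      moreover have "?\<tau> \<subset> \<sigma>" using uv by blast
      ultimately show False using min by (auto simp: minimal_presentation_def)
    qed
    then show "s \<in> disconnected_degrees p n"
      using uv sub unfolding disconnected_degrees_def by blast
  next
    fix s assume "s \<in> disconnected_degrees p n"
    then obtain u v where uv: "(u, v) \<in> ?K" "(u, v) \<notin> ?L\<^sup>*" "s = factor_hom p n u"
      by (auto simp: disconnected_degrees_def)
    have "(u, v) \<in> (\<sigma> \<union> \<sigma>\<inverse> \<union> ?L)\<^sup>*" using uv conn by blast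
    \<comment> \<open>Invariant along the path: either only links have been used so far, or a pair
      of \<open>\<sigma>\<close> in degree \<open>s\<close> has been met.\<close>
    then have "(u, v) \<in> ?L\<^sup>* \<or> (\<exists>a b. (a, b) \<in> \<sigma> \<and> factor_hom p n a = s)"
    proof (induction rule: rtrancl_induct)
      case (step y z)
      have "factor_hom p n a = factor_hom p n b" if "(a, b) \<in> \<sigma>" for a b
        using that sub kernel_congruence_iff by blast
      then show ?case
        using step uv(3) factor_hom_rtrancl_linked[of u y p n]
        by (metis Un_iff converseD rtrancl.rtrancl_into_rtrancl)
    qed simp
    then show "s \<in> {factor_hom p n u | u v. (u, v) \<in> \<sigma>}" using uv by auto
  }
qed

lemma Betti_eq_disconnected_degrees:
  assumes "\<forall>i\<in>{1..p}. n i > 0"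
  shows "Betti p n = disconnected_degrees p n"
  using minimal_presentation_degrees[OF assms] someI_ex[OF minimal_presentation_exists[OF assms]]
  unfolding Betti_def Let_def by blast



section \<open>Minimal generators\<close>

lemma submonoid_generated: "submonoid (generated A)"
  unfolding generated_def by (rule hull_in) (auto simp: submonoid_def)

lemma submonoid_sum:
  fixes f u :: "nat \<Rightarrow> nat"
  assumes M: "submonoid M" and fM: "\<And>i. i \<in> I \<Longrightarrow> f i \<in> M"
  shows "(\<Sum>i\<in>I. u i * f i) \<in> M"
proof -
  have mult: "k * x \<in> M" if "x \<in> M" for k x
    by (induction k) (use M that in \<open>auto simp: submonoid_def\<close>)
  show ?thesis
  proof (cases "finite I")
    case True
    then show ?thesis using fM
      by (induction I) (use M mult in \<open>auto simp: submonoid_def\<close>)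
  qed (use M in \<open>simp add: submonoid_def\<close>)
qed

lemma generated_image:
  fixes n :: "nat \<Rightarrow> nat"
  assumes "finite I"
  shows "generated (n ` I) = range (\<lambda>u. \<Sum>i\<in>I. u i * n i)"
  unfolding generated_def
proof (rule hull_unique)
  show "n ` I \<subseteq> range (\<lambda>u. \<Sum>i\<in>I. u i * n i)"
  proof clarify
    fix i assume "i \<in> I"
    then have "n i = (\<Sum>j\<in>I. (if j = i then 1 else 0) * n j)"
      using assms by (simp add: if_distrib[of "\<lambda>x. x * _"] cong: if_cong)
    then show "n i \<in> range (\<lambda>u. \<Sum>i\<in>I. u i * n i)"
      by (rule range_eqI[of _ _ "\<lambda>j. if j = i then 1 else 0"])
  qed
  show "submonoid (range (\<lambda>u. \<Sum>i\<in>I. u i * n i))"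
    unfolding submonoid_def
  proof (intro conjI ballI)
    show "0 \<in> range (\<lambda>u. \<Sum>i\<in>I. u i * n i)" by (rule range_eqI[of _ _ "\<lambda>_. 0"]) simp
    fix x y assume "x \<in> range (\<lambda>u. \<Sum>i\<in>I. u i * n i)" "y \<in> range (\<lambda>u. \<Sum>i\<in>I. u i * n i)"
    then obtain u v where "x = (\<Sum>i\<in>I. u i * n i)" "y = (\<Sum>i\<in>I. v i * n i)" by blast
    then have "x + y = (\<Sum>i\<in>I. (u i + v i) * n i)" by (simp add: algebra_simps sum.distrib)
    then show "x + y \<in> range (\<lambda>u. \<Sum>i\<in>I. u i * n i)"
      by (rule range_eqI[of _ _ "\<lambda>i. u i + v i"])
  qed
  show "range (\<lambda>u. \<Sum>i\<in>I. u i * n i) \<subseteq> M" if "n ` I \<subseteq> M" "submonoid M" for M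
    using that submonoid_sum[OF that(2), of I n] by blast
qed

text \<open>Restates the condition behind \<open>least_mult\<close> in terms of fibres, where it can
  be compared with the tuple \<open>c_i e_i\<close>.\<close>

lemma generated_others_iff:
  assumes i: "i \<in> {1..p}"
  shows "m \<in> generated (n ` ({1..p} - {i})) \<longleftrightarrow>
    (\<exists>v\<in>tuples p. v i = 0 \<and> factor_hom p n v = m)"
proof -
  have *: "factor_hom p n v = (\<Sum>j\<in>{1..p} - {i}. v j * n j)" if "v i = 0" for v
    using i that by (simp add: factor_hom_def sum.remove)
  have "finite ({1..p} - {i})" by simp
  note gen = generated_image[OF this, of n]
  show ?thesis
  proof
    assume "m \<in> generated (n ` ({1..p} - {i}))"
    then obtain u where u: "m = (\<Sum>j\<in>{1..p} - {i}. u j * n j)" unfolding gen by blast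
    let ?v = "\<lambda>j. if j \<in> {1..p} - {i} then u j else 0"
    have "?v \<in> tuples p" "?v i = 0" by (auto simp: tuples_def)
    moreover have "factor_hom p n ?v = m" unfolding *[of ?v, OF \<open>?v i = 0\<close>] u by (rule sum.cong) auto
    ultimately show "\<exists>v\<in>tuples p. v i = 0 \<and> factor_hom p n v = m" by (intro bexI[of _ ?v] conjI)
  next
    assume "\<exists>v\<in>tuples p. v i = 0 \<and> factor_hom p n v = m"
    then obtain v where "v i = 0" "factor_hom p n v = m" by blast
    then show "m \<in> generated (n ` ({1..p} - {i}))"
      unfolding gen using *[of v] by (intro range_eqI[of _ _ v]) simp
  qed
qed

lemma mult_in_generated_others:
  fixes n :: "nat \<Rightarrow> nat"
  assumes "i \<in> {1..p}" "j \<in> {1..p}" "j \<noteq> i"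
  shows "k * n j \<in> generated (n ` ({1..p} - {i}))"
  unfolding generated_others_iff[OF assms(1)]
  using assms single_in_tuples[OF assms(2)] factor_hom_single[OF assms(2)]
  by (intro bexI[of _ "\<lambda>l. if l = j then k else 0"]) auto

lemma ex_other_index:
  fixes p i :: nat
  assumes "p \<ge> 2"
  obtains j where "j \<in> {1..p}" "j \<noteq> i"
proof
  show "(if i = 1 then 2 else 1) \<in> {1..p}" "(if i = 1 then 2 else 1) \<noteq> i" using assms by auto
qed

lemma minimal_generator_notin:
  assumes "minimally_generates A S" "a \<in> A"
  shows "a \<notin> generated (A - {a})"
proof
  assume a: "a \<in> generated (A - {a})"
  have "A - {a} \<subseteq> generated (A - {a})" unfolding generated_def by (rule hull_subset)
  with a have "A \<subseteq> generated (A - {a})" by blast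
  then have "generated A \<subseteq> generated (A - {a})"
    unfolding generated_def[of A] by (rule hull_minimal) (rule submonoid_generated)
  moreover have "generated (A - {a}) \<subseteq> generated A"
    unfolding generated_def by (rule hull_mono) blast
  ultimately show False using assms unfolding minimally_generates_def by blast
qed

lemma minimal_generator_pos:
  assumes "minimally_generates A S" "a \<in> A"
  shows "a > 0"
proof (rule ccontr)
  assume "\<not> a > 0"
  then show False
    using minimal_generator_notin[OF assms] submonoid_generated by (auto simp: submonoid_def)
qed


section \<open>The fibre of \<open>c_i n_i\<close>\<close>

lemma
  fixes n :: "nat \<Rightarrow> nat"
  assumes p: "p \<ge> 2" and pos: "\<forall>i\<in>{1..p}. n i > 0" and i: "i \<in> {1..p}"
  shows least_mult_pos: "least_mult p n i > 0"
    and least_mult_generated: "least_mult p n i * n i \<in> generated (n ` ({1..p} - {i}))"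
proof -
  let ?P = "\<lambda>k. k \<noteq> 0 \<and> k * n i \<in> generated (n ` ({1..p} - {i}))"
  obtain j where j: "j \<in> {1..p}" "j \<noteq> i" using ex_other_index[OF p] .
  \<comment> \<open>The multiplier \<open>n j\<close> is admissible, because \<open>n j\<close>
    copies of \<open>n i\<close> equal \<open>n i\<close> copies of \<open>n j\<close>. Hence the
    minimum is attained.\<close>
  have "n j * n i \<in> generated (n ` ({1..p} - {i}))"
    using mult_in_generated_others[OF i j, of "n i" n] by (simp only: mult.commute)
  moreover have "n j \<noteq> 0" using pos j by blast
  ultimately have "?P (n j)" by blast
  then have "?P (least_mult p n i)" unfolding least_mult_def by (rule LeastI)
  then show "least_mult p n i > 0" "least_mult p n i * n i \<in> generated (n ` ({1..p} - {i}))"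
    by auto
qed

lemma least_mult_le:
  assumes "k > 0" "k * n i \<in> generated (n ` ({1..p} - {i}))"
  shows "least_mult p n i \<le> k"
  unfolding least_mult_def by (rule Least_le) (use assms in simp)

lemma factor_hom_eq_0:
  assumes "\<forall>i\<in>{1..p}. n i > 0" "u \<in> tuples p" "factor_hom p n u = 0"
  shows "u = (\<lambda>_. 0)"
proof
  fix i
  show "u i = 0"
    using assms by (cases "i \<in> {1..p}") (force simp: factor_hom_def tuples_def)+
qed

text \<open>Removing all copies of generator \<open>i\<close> from \<open>u\<close> writes
  \<open>(c_i - u i) * n i\<close> in terms of the other generators. Minimality of c_i forces
  \<open>u i\<close> to be c_i, and the remainder then has degree zero.\<close>

lemma fibre_least_mult:
  fixes n :: "nat \<Rightarrow> nat"
  assumes pos: "\<forall>i\<in>{1..p}. n i > 0" and i: "i \<in> {1..p}"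
    and u: "u \<in> tuples p" "factor_hom p n u = least_mult p n i * n i" "u i > 0"
  shows "u = (\<lambda>j. if j = i then least_mult p n i else 0)"
proof -
  let ?c = "least_mult p n i"
  obtain w where w: "w \<in> tuples p" "u = (\<lambda>j. w j + (if j = i then u i else 0))"
    and fw: "factor_hom p n u = factor_hom p n w + u i * n i"
    using tuples_split[OF u(1) i order_refl] by blast
  have wi: "w i = 0" using fun_cong[OF w(2), of i] by simp
  have "u i * n i \<le> ?c * n i" using fw u(2) by simp
  then have le: "u i \<le> ?c" using pos i by simp
  have fw': "factor_hom p n w = (?c - u i) * n i" using fw u(2) by (simp add: diff_mult_distrib)
  have "u i = ?c"
  proof (rule ccontr)
    assume "u i \<noteq> ?c"
    moreover have "(?c - u i) * n i \<in> generated (n ` ({1..p} - {i}))"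
      using w wi fw' unfolding generated_others_iff[OF i] by blast
    ultimately have "?c \<le> ?c - u i" using le by (intro least_mult_le) auto
    then show False using le u(3) by simp
  qed
  moreover from this have "w j = 0" for j using factor_hom_eq_0[OF pos w(1)] fw' by simp
  ultimately show ?thesis by (intro ext, subst w(2)) simp
qed

text \<open>A neighbour of \<open>c_i e_i\<close> has a positive \<open>i\<close>-th entry, so it is
  \<open>c_i e_i\<close> itself. The definition of c_i supplies a second tuple of the same fibre,
  one that vanishes at \<open>i\<close>.\<close>

lemma least_mult_in_disconnected_degrees:
  fixes n :: "nat \<Rightarrow> nat"
  assumes p: "p \<ge> 2" and pos: "\<forall>i\<in>{1..p}. n i > 0" and i: "i \<in> {1..p}"
  shows "least_mult p n i * n i \<in> disconnected_degrees p n"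
proof -
  let ?c = "least_mult p n i"
  let ?u = "\<lambda>j. if j = i then ?c else 0"
  obtain v where v: "v \<in> tuples p" "v i = 0" "factor_hom p n v = ?c * n i"
    using least_mult_generated[OF assms] unfolding generated_others_iff[OF i] by blast
  have fu: "factor_hom p n ?u = ?c * n i" by (rule factor_hom_single[OF i])
  have "y = ?u" if "(?u, y) \<in> (linked p n)\<^sup>*" for y
    using that
  proof (induction rule: rtrancl_induct)
    case (step y z)
    have "factor_hom p n z = ?c * n i" "z \<in> tuples p" "z i > 0"
      using step.hyps(2) fu unfolding step.IH
      by (auto simp: linked_def kernel_congruence_iff split: if_splits)
    then show ?case using fibre_least_mult[OF pos i] by blast
  qed simp
  then have "(?u, v) \<notin> (linked p n)\<^sup>*" using v(2) least_mult_pos[OF assms] by fastforce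
  moreover have "(?u, v) \<in> kernel_congruence p n"
    using v fu single_in_tuples[OF i] by (simp add: kernel_congruence_iff)
  ultimately show ?thesis 
    unfolding disconnected_degrees_def mem_Collect_eq
    by (intro exI[of _ ?u] exI[of _ v]) (use fu in auto)
qed


section \<open>Divisibility\<close>

lemma prod_dvd_of_pairwise_coprime:
  fixes k :: "'a \<Rightarrow> nat"
  assumes "finite I" "pairwise (\<lambda>i j. coprime (k i) (k j)) I" "\<And>i. i \<in> I \<Longrightarrow> k i dvd m"
  shows "(\<Prod>i\<in>I. k i) dvd m"
  using assms
proof (induction I)
  case (insert x I)
  have "coprime (k x) (\<Prod>i\<in>I. k i)"
    using insert by (intro prod_coprime_right) (auto simp: pairwise_def)
  moreover have "(\<Prod>i\<in>I. k i) dvd m" using insert by (auto simp: pairwise_insert)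
  ultimately show ?case using insert by (simp add: divides_mult)
qed simp

lemma numerical_semigroup_common_divisor:
  assumes "numerical_semigroup S" "\<And>x. x \<in> S \<Longrightarrow> m dvd x"
  shows "m = 1"
proof -
  have "finite (UNIV - S)" using assms(1) by (simp add: numerical_semigroup_def)
  then obtain N where "\<forall>x\<in>UNIV - S. x \<le> N" using finite_nat_set_iff_bounded_le by blast
  \<comment> \<open>Two consecutive elements beyond all gaps.\<close>
  then have "Suc N \<in> S" "Suc (Suc N) \<in> S" by force+
  then have "m dvd Suc N" "m dvd Suc N + 1" using assms(2) by simp_all
  then show ?thesis using dvd_add_right_iff by (metis nat_dvd_1_iff_1)
qed

text \<open>Agreement of the \<open>i\<close>-th entries modulo c_i is itself a congruence
  \<open>?T\<close>, so it suffices to check it on a minimal presentation. All pairs there have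
  degree \<open>b\<close>, which is also the degree of \<open>c_i e_i\<close>, and in that fibre an
  \<open>i\<close>-th entry is 0 or c_i.\<close>

lemma kernel_cong_least_mult:
  fixes n :: "nat \<Rightarrow> nat"
  assumes pos: "\<forall>i\<in>{1..p}. n i > 0"
    and b: "disconnected_degrees p n \<subseteq> {b}" "\<forall>i\<in>{1..p}. least_mult p n i * n i = b"
    and i: "i \<in> {1..p}" and uv: "(u, v) \<in> kernel_congruence p n"
  shows "[u i = v i] (mod least_mult p n i)"
proof -
  let ?c = "least_mult p n i"
  let ?T = "{(u, v). u \<in> tuples p \<and> v \<in> tuples p \<and> [u i = v i] (mod ?c)}"
  obtain \<sigma> where min: "minimal_presentation p n \<sigma>"
    using minimal_presentation_exists[OF pos] by blast
  then have pres: "tuple_congruence p hull \<sigma> = kernel_congruence p n"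
    by (simp add: minimal_presentation_def presentation_def)
  have "tuple_congruence p ?T"
    unfolding tuple_congruence_def
    by (auto intro!: equivI refl_onI symI transI tuples_add mod_add_cong simp: cong_def)
  moreover have "\<sigma> \<subseteq> ?T"
  proof clarify
    fix x y assume xy: "(x, y) \<in> \<sigma>"
    then have "factor_hom p n x = b"
      using minimal_presentation_degrees[OF pos min] b(1) by blast
    moreover have ker: "(x, y) \<in> kernel_congruence p n"
      using xy pres hull_subset[of \<sigma> "tuple_congruence p"] by blast
    ultimately have deg: "z \<in> tuples p \<and> factor_hom p n z = ?c * n i" if "z = x \<or> z = y" for z
      using that b(2) i by (auto simp: kernel_congruence_iff)
    have "z i = 0 \<or> z i = ?c" if "z = x \<or> z = y" for z
      using deg[OF that] fibre_least_mult[OF pos i, of z] by (metis not_gr0)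
    then have "x i mod ?c = 0" "y i mod ?c = 0" by (metis mod_0 mod_self)+
    then have "[x i = y i] (mod ?c)" by (simp add: cong_def)
    then show "x \<in> tuples p \<and> y \<in> tuples p \<and> [x i = y i] (mod ?c)"
      using ker by (simp add: kernel_congruence_iff)
  qed
  ultimately have "tuple_congruence p hull \<sigma> \<subseteq> ?T" by (intro hull_minimal)
  then show ?thesis using uv pres by blast
qed

lemma least_mult_coprime_product_form:
  fixes n :: "nat \<Rightarrow> nat"
  assumes p: "p \<ge> 2" and S: "numerical_semigroup S" "inj_on n {1..p}"
    and gen: "minimally_generates (n ` {1..p}) S"
    and b: "disconnected_degrees p n = {b}"
  shows "coprime_product_form p n (least_mult p n)"
proof -
  let ?c = "least_mult p n"
  have pos: "\<forall>i\<in>{1..p}. n i > 0" using minimal_generator_pos[OF gen] by blast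
  have cb: "\<forall>i\<in>{1..p}. ?c i * n i = b"
    using least_mult_in_disconnected_degrees[OF p pos] b by blast
  have c_pos: "?c i > 0" if "i \<in> {1..p}" for i by (rule least_mult_pos[OF p pos that])
  \<comment> \<open>The entrywise congruence for \<open>x e_i\<close> and \<open>y e_j\<close>; the
    conditional factor is the \<open>i\<close>-th entry of \<open>e_j\<close>.\<close>
  have ker: "[x = y * (if j = i then 1 else 0)] (mod ?c i)"
    if "i \<in> {1..p}" "j \<in> {1..p}" "x * n i = y * n j" for i j x y
  proof -
    let ?u = "\<lambda>k. if k = i then x else 0" and ?v = "\<lambda>k. if k = j then y else 0"
    have "(?u, ?v) \<in> kernel_congruence p n"
      using that by (simp add: kernel_congruence_iff factor_hom_single single_in_tuples)
    from kernel_cong_least_mult[OF pos equalityD1[OF b] cb that(1) this] show ?thesis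
      by (auto split: if_splits)
  qed
  \<comment> \<open>Compares \<open>n j\<close> copies of generator \<open>i\<close> with
    \<open>n i\<close> copies of generator \<open>j\<close>.\<close>
  have c_dvd: "?c i dvd n j" if "i \<in> {1..p}" "j \<in> {1..p}" "i \<noteq> j" for i j
    using ker[OF that(1,2), of "n j" "n i"] that(3) by (simp add: cong_0_iff mult.commute)
  have coprime: "pairwise (\<lambda>i j. coprime (?c i) (?c j)) {1..p}"
  proof (rule pairwiseI)
    fix i j assume ij: "i \<in> {1..p}" "j \<in> {1..p}" "i \<noteq> j"
    define d where "d = gcd (?c i) (?c j)"
    obtain x y where x: "?c i = d * x" and y: "?c j = d * y" by (metis d_def dvdE gcd_dvd1 gcd_dvd2)
    have d: "d > 0" "x > 0" using c_pos[OF ij(1)] x by auto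
    have "d * (x * n i) = d * (y * n j)" using cb ij x y by (metis mult.assoc)
    then have "x * n i = y * n j" using d by simp
    \<comment> \<open>Cancelling the gcd \<open>d\<close> from \<open>c_i n_i = c_j n_j\<close>
      leaves a kernel pair whose \<open>i\<close>-th entries are \<open>x\<close> and 0. So
      \<open>d * x\<close> divides the positive number \<open>x\<close>, which forces
      \<open>d\<close> to be one.\<close>
    then have "?c i dvd x" using ker[OF ij(1,2)] ij(3) by (simp add: cong_0_iff)
    then have "d * x \<le> x" using x d by (simp add: dvd_imp_le)
    then have "d = 1" using d by simp
    then show "coprime (?c i) (?c j)" unfolding d_def by (simp add: coprime_iff_gcd_eq_1)
  qed
  let ?N = "\<Prod>j\<in>{1..p}. ?c j" and ?N' = "\<lambda>i. \<Prod>j\<in>{1..p} - {i}. ?c j"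
  have N: "?N = ?c i * ?N' i" if "i \<in> {1..p}" for i
    using that by (simp add: prod.remove)
  have N_pos: "?N > 0" using c_pos by (simp add: prod_pos)
  \<comment> \<open>The cofactor of \<open>n i\<close> over the product of the other c_j is the same
    for every \<open>i\<close>, since \<open>c_i n_i = b\<close> throughout. It divides all of
    \<open>S\<close>, hence equals one.\<close>
  define m where "m = b div ?N"
  have nm: "n i = m * ?N' i" if i: "i \<in> {1..p}" for i
  proof -
    have "?N' i dvd n i"
      using coprime c_dvd i by (intro prod_dvd_of_pairwise_coprime) (auto simp: pairwise_def)
    then obtain t where t: "n i = ?N' i * t" by blast
    have "b = t * ?N" using cb i N[OF i] t by (metis mult.assoc mult.commute)
    then have "m = t" using N_pos m_def by simp
    then show ?thesis using t by simp
  qed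
  have "m dvd x" if "x \<in> S" for x
  proof -
    have "x \<in> range (\<lambda>u. \<Sum>i\<in>{1..p}. u i * n i)"
      using that gen generated_image[of "{1..p}" n] by (simp add: minimally_generates_def)
    then obtain u where "x = (\<Sum>i\<in>{1..p}. u i * n i)" by blast
    moreover have "m dvd u i * n i" if "i \<in> {1..p}" for i
      by (subst nm[OF that]) simp
    ultimately show ?thesis by (auto intro: dvd_sum)
  qed
  then have "m = 1" by (rule numerical_semigroup_common_divisor[OF S(1)])
  moreover have "?c i > 1" if i: "i \<in> {1..p}" for i
  proof (rule ccontr)
    assume "\<not> ?c i > 1"
    then have "?c i = 1" using c_pos[OF i] by simp
    then have "n i \<in> generated (n ` ({1..p} - {i}))"
      using least_mult_generated[OF p pos i] by simp
    \<comment> \<open>Distinctness of the generators makes deleting the index \<open>i\<close> the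
      same as deleting the value \<open>n i\<close>.\<close>
    moreover have "n ` ({1..p} - {i}) = n ` {1..p} - {n i}"
      using inj_on_image_set_diff[OF S(2), of "{1..p}" "{i}"] i by simp
    ultimately show False using minimal_generator_notin[OF gen] i by auto
  qed
  ultimately show ?thesis
    unfolding coprime_product_form_def using coprime nm by simp
qed


section \<open>Generators in coprime product form\<close>

lemma coprime_product_form_mult:
  assumes "coprime_product_form p n k" "i \<in> {1..p}"
  shows "k i * n i = (\<Prod>j\<in>{1..p}. k j)"
  using assms by (simp add: coprime_product_form_def prod.remove)

text \<open>Modulo \<open>k i\<close> every generator except \<open>n i\<close> vanishes, and
  \<open>n i\<close> is invertible, so the degree determines the \<open>i\<close>-th entry.\<close>

lemma coprime_product_form_kernel_cong:
  assumes k: "coprime_product_form p n k" and i: "i \<in> {1..p}"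
    and uv: "factor_hom p n u = factor_hom p n v"
  shows "[u i = v i] (mod k i)"
proof -
  have dvd: "k i dvd n j" if "j \<in> {1..p} - {i}" for j
  proof -
    have "n j = (\<Prod>l\<in>{1..p} - {j}. k l)" using k that by (simp add: coprime_product_form_def)
    moreover have "k i dvd (\<Prod>l\<in>{1..p} - {j}. k l)" using that i by (intro dvd_prodI) auto
    ultimately show ?thesis by simp
  qed
  have *: "[factor_hom p n w = w i * n i] (mod k i)" for w
  proof -
    have "factor_hom p n w = w i * n i + (\<Sum>j\<in>{1..p} - {i}. w j * n j)"
      using i by (simp add: factor_hom_def sum.remove)
    moreover have "k i dvd (\<Sum>j\<in>{1..p} - {i}. w j * n j)"
      using dvd by (intro dvd_sum) auto
    ultimately show ?thesis by (simp add: cong_def mod_add_right_eq[symmetric])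
  qed
  have "[u i * n i = v i * n i] (mod k i)" using *[of u] *[of v] uv by (metis cong_sym cong_trans)
  moreover have "coprime (k i) (\<Prod>j\<in>{1..p} - {i}. k j)"
    using k i by (intro prod_coprime_right) (auto simp: coprime_product_form_def pairwise_def)
  then have "coprime (n i) (k i)"
    using k i by (simp add: coprime_product_form_def coprime_commute)
  ultimately show ?thesis by (simp add: cong_mult_rcancel_nat)
qed

text \<open>Since \<open>k i * n i = k j * n j\<close>, the number \<open>k i\<close> is an
  admissible multiplier. Conversely, comparing \<open>c_i e_i\<close> with a tuple of its fibre
  vanishing at \<open>i\<close> shows that \<open>k i\<close> divides c_i.\<close>

lemma coprime_product_form_least_mult:
  assumes p: "p \<ge> 2" and pos: "\<forall>i\<in>{1..p}. n i > 0"
    and k: "coprime_product_form p n k" and i: "i \<in> {1..p}"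
  shows "least_mult p n i = k i"
proof (rule antisym)
  let ?c = "least_mult p n i"
  obtain j where j: "j \<in> {1..p}" "j \<noteq> i" using ex_other_index[OF p] .
  have "k i * n i = k j * n j" using coprime_product_form_mult[OF k] i j by metis
  then have "k i * n i \<in> generated (n ` ({1..p} - {i}))"
    using mult_in_generated_others[OF i j] by (simp only:)
  moreover have "k i > 1" using k i unfolding coprime_product_form_def by blast
  ultimately show "?c \<le> k i" by (intro least_mult_le) simp_all
  obtain v where v: "v i = 0" "factor_hom p n v = ?c * n i"
    using least_mult_generated[OF p pos i] unfolding generated_others_iff[OF i] by blast
  have "[(\<lambda>l. if l = i then ?c else 0) i = v i] (mod k i)"
    by (rule coprime_product_form_kernel_cong[OF k i]) (simp add: factor_hom_single[OF i] v(2))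
  then have "k i dvd ?c" using v(1) by (simp add: cong_0_iff)
  then show "k i \<le> ?c" using least_mult_pos[OF p pos i] by (rule dvd_imp_le)
qed

text \<open>Tuples in the same fibre with disjoint supports have all entries divisible by the
  respective \<open>k i\<close>, so \<open>k i\<close> copies of the generator \<open>i\<close> in the first can be traded for
  \<open>k j\<close> copies of a generator \<open>j\<close> of the second.\<close>

lemma coprime_product_form_disconnected_degrees:
  assumes pos: "\<forall>i\<in>{1..p}. n i > 0" and k: "coprime_product_form p n k"
  shows "disconnected_degrees p n \<subseteq> {\<Prod>j\<in>{1..p}. k j}"
proof
  fix s assume "s \<in> disconnected_degrees p n"
  then obtain u v where u: "u \<in> tuples p" and v: "v \<in> tuples p"
    and uv: "factor_hom p n u = factor_hom p n v" and s: "s = factor_hom p n u"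
    and L: "(u, v) \<notin> (linked p n)\<^sup>*"
    by (auto simp: disconnected_degrees_def kernel_congruence_iff)
  have ker: "(u, v) \<in> kernel_congruence p n" using u v uv by (simp add: kernel_congruence_iff)
  have disjoint: "u i = 0 \<or> v i = 0" for i
    using L linkedI[OF ker, of i] by blast
  have "u \<noteq> v" using L by auto
  have nonzero: "factor_hom p n u \<noteq> 0"
  proof
    assume "factor_hom p n u = 0"
    then have "u = (\<lambda>_. 0)" "v = (\<lambda>_. 0)"
      using factor_hom_eq_0[OF pos u] factor_hom_eq_0[OF pos v] uv by simp_all
    then show False using \<open>u \<noteq> v\<close> by simp
  qed
  have ex_pos: "\<exists>i. x i > 0" if "factor_hom p n x \<noteq> 0" for x
    using that by (auto simp: factor_hom_def)
  have "\<exists>i. u i > 0" using nonzero by (rule ex_pos)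
  moreover have "\<exists>j. v j > 0" using nonzero unfolding uv by (rule ex_pos)
  ultimately obtain i j where ui: "u i > 0" and vj: "v j > 0" by blast
  have i: "i \<in> {1..p}" and j: "j \<in> {1..p}"
    using tuples_support[OF u ui] tuples_support[OF v vj] .
  have "v i = 0" using disjoint[of i] ui by simp
  then have "k i dvd u i"
    using coprime_product_form_kernel_cong[OF k i uv] by (simp add: cong_0_iff)
  then have le: "k i \<le> u i" using ui by (rule dvd_imp_le)
  obtain w where w: "w \<in> tuples p" "u = (\<lambda>l. w l + (if l = i then k i else 0))"
    "factor_hom p n u = factor_hom p n w + k i * n i"
    using tuples_split[OF u i le] by blast
  \<comment> \<open>If \<open>w\<close> were nonzero at \<open>l\<close>, the traded tuple
    \<open>?u'\<close> would share \<open>l\<close> with \<open>u\<close> and \<open>j\<close> with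
    \<open>v\<close>, linking \<open>u\<close> to \<open>v\<close> in two steps. So \<open>u\<close>
    is \<open>k i\<close> copies of generator \<open>i\<close>, and the degree is the full
    product.\<close>
  have w0: "w l = 0" for l
  proof (rule ccontr)
    assume wl: "w l \<noteq> 0"
    let ?u' = "\<lambda>l. w l + (if l = j then k j else 0)"
    have u': "?u' \<in> tuples p" using w(1) single_in_tuples[OF j] by (rule tuples_add)
    have "factor_hom p n ?u' = factor_hom p n w + k j * n j"
      by (subst factor_hom_add, subst factor_hom_single[OF j]) simp
    then have fu': "factor_hom p n ?u' = factor_hom p n u"
      using w(3) coprime_product_form_mult[OF k i] coprime_product_form_mult[OF k j] by simp
    have "(u, ?u') \<in> kernel_congruence p n" "(?u', v) \<in> kernel_congruence p n"
      using u v u' fu' uv by (simp_all only: kernel_congruence_iff)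
    note link = linkedI[OF this(1), of l] linkedI[OF this(2), of j]
    have "u l > 0" using wl fun_cong[OF w(2), of l] by simp
    then have "(u, ?u') \<in> linked p n" by (rule link(1)) (use wl in simp)
    moreover have "k j > 1" using k j unfolding coprime_product_form_def by blast
    then have "(?u', v) \<in> linked p n" by (intro link(2) vj) simp
    ultimately show False using L by (blast intro: rtrancl_into_rtrancl)
  qed
  then have "factor_hom p n w = 0" by (simp add: factor_hom_def)
  then show "s \<in> {\<Prod>j\<in>{1..p}. k j}"
    unfolding s w(3) coprime_product_form_mult[OF k i] by simp
qed

section \<open>Assembling the equivalence and its two supplements\<close>

theorem mainTheorem3:
  fixes S :: "nat set" and p :: nat and n :: "nat \<Rightarrow> nat"
  assumes "numerical_semigroup S"
    and "p \<ge> 2"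
    and "inj_on n {1..p}"
    and "minimally_generates (n ` {1..p}) S"
  shows "(is_singleton (Betti p n) \<longleftrightarrow> (\<exists>k. coprime_product_form p n k)) \<and>
    (\<forall>k. coprime_product_form p n k \<longrightarrow> (\<forall>i\<in>{1..p}. k i = least_mult p n i)) \<and>
    (is_singleton (Betti p n) \<longrightarrow>
       Betti p n = {least_mult p n 1 * n 1} \<and>
       Betti p n = {least_mult p n i * n i | i. i \<in> {1..p}})"
proof -
  have pos: "\<forall>i\<in>{1..p}. n i > 0" using minimal_generator_pos[OF assms(4)] by blast
  have B: "Betti p n = disconnected_degrees p n" by (rule Betti_eq_disconnected_degrees[OF pos])
  have one: "1 \<in> {1..p}" using assms(2) by simp
  have mem: "least_mult p n i * n i \<in> Betti p n" if "i \<in> {1..p}" for i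
    unfolding B using least_mult_in_disconnected_degrees[OF assms(2) pos that] .
  have form: "coprime_product_form p n (least_mult p n)" if single: "is_singleton (Betti p n)"
  proof -
    obtain b where "Betti p n = {b}" using single by (rule is_singletonE)
    then show ?thesis using least_mult_coprime_product_form[OF assms(2,1,3,4)] B by simp
  qed
  \<comment> \<open>The degree \<open>c_1 n_1\<close> gives existence, and the bound by the product
    of all \<open>k j\<close> gives uniqueness.\<close>
  have single: "is_singleton (Betti p n)" if k: "coprime_product_form p n k" for k
  proof (rule is_singletonI')
    show "Betti p n \<noteq> {}" using mem[OF one] by blast
    show "x = y" if "x \<in> Betti p n" "y \<in> Betti p n" for x y
      using that coprime_product_form_disconnected_degrees[OF pos k] unfolding B by blast
  qed
  have degrees: "Betti p n = {least_mult p n 1 * n 1}"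
    "Betti p n = {least_mult p n i * n i | i. i \<in> {1..p}}" if single: "is_singleton (Betti p n)"
  proof -
    obtain b where b: "Betti p n = {b}" using single by (rule is_singletonE)
    have eq: "least_mult p n i * n i = b" if "i \<in> {1..p}" for i
      using mem[OF that] unfolding b by (rule singletonD)
    show "Betti p n = {least_mult p n 1 * n 1}" unfolding b eq[OF one] ..
    show "Betti p n = {least_mult p n i * n i | i. i \<in> {1..p}}"
      unfolding b using eq one by blast
  qed
  show ?thesis
  proof (intro conjI allI impI ballI iffI)
    show "\<exists>k. coprime_product_form p n k" if "is_singleton (Betti p n)"
      using form[OF that] by blast
    show "is_singleton (Betti p n)" if "\<exists>k. coprime_product_form p n k"
      using that single by blast
    show "k i = least_mult p n i" if "coprime_product_form p n k" "i \<in> {1..p}" for k i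
      using coprime_product_form_least_mult[OF assms(2) pos that] by (rule sym)
  qed (fact degrees)+
qed

end
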